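(* Let $\mathfrak{R}(o)\subset\mathbb{R}^2$ be a bounded convex region of positive area with center of mass at the origin, let $u\in\mathfrak{R}(o)$, and let $V$ be uniformly distributed in $\mathfrak{R}(o)$. Let $(R,\Theta)$ be the distance and azimuth angle of $V$ as seen from $u$, i.e. $V-u=(R\cos\Theta,R\sin\Theta)$ with $R\ge0$, $\Theta\in[0,2\pi)$. Let $\mathfrak{R}(-u)=\{v-u: v\in\mathfrak{R}(o)\}$ and, for $\phi\in[0,2\pi]$, $\beta(\phi)=\sup\{\rho\ge 0:(\rho\cos\phi,\rho\sin\phi)\in\mathfrak{R}(-u)\}$. Then for all $r\ge 0$ and $\theta\in[0,2\pi]$, $$\Pr(R\le r,\Theta\le\theta)=\frac{1}{|\mathfrak{R}(o)|}\left(\frac12\int_0^\theta r^2\,\mathbf 1(r\le\beta(\phi))\,d\phi+\frac12\int_0^\theta\beta^2(\phi)\,\mathbf 1(r>\beta(\phi))\,d\phi\right).$$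
   Context: $|\cdot|$ denotes Lebesgue measure (area) in $\mathbb{R}^2$; $\mathbf 1(\cdot)$ is the indicator of a condition. *)

theory Defs
  imports "HOL-Probability.Probability"
begin

text \<open>A bounded convex planar set is Lebesgue measurable but need not be Borel (an arbitrary part
  of its boundary may belong to it), so areas are taken with respect to \<^const>\<open>lebesgue\<close>.\<close>

definition center_of_mass :: "(real^2) set \<Rightarrow> real^2" where
  "center_of_mass K = (1 / measure lebesgue K) *\<^sub>R integral K (\<lambda>x. x)"

text \<open>Random vectors are only required to be Borel measurable. The constant
  \<^const>\<open>uniform_measure\<close> on \<^const>\<open>lborel\<close> would not do, because the set may fail to be Borel.\<close>

definition uniformly_distributed_in :: "'w measure \<Rightarrow> ('w \<Rightarrow> real^2) \<Rightarrow> (real^2) set \<Rightarrow> bool" where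
  "uniformly_distributed_in M V K \<longleftrightarrow>
     V \<in> borel_measurable M \<and>
     (\<forall>A \<in> sets borel. measure M (V -` A \<inter> space M) = measure lebesgue (A \<inter> K) / measure lebesgue K)"

definition polar_point :: "real \<Rightarrow> real \<Rightarrow> real^2" where
  "polar_point \<rho> \<phi> = vector [\<rho> * cos \<phi>, \<rho> * sin \<phi>]"

definition shifted_region :: "(real^2) set \<Rightarrow> real^2 \<Rightarrow> (real^2) set" where
  "shifted_region K u = {v - u | v. v \<in> K}"

definition radial_extent :: "(real^2) set \<Rightarrow> real^2 \<Rightarrow> real \<Rightarrow> real" where
  "radial_extent K u \<phi> = Sup {\<rho>. \<rho> \<ge> 0 \<and> polar_point \<rho> \<phi> \<in> shifted_region K u}"

end

theory Submission
  imports Defs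
begin

text \<open>Since \<open>V \<noteq> u\<close> almost surely, the event in question is, up to a null set, that \<open>V\<close> lies in the
  compact sector \<open>u + {(\<rho> cos \<phi>, \<rho> sin \<phi>) | 0 \<le> \<rho> \<le> r, 0 \<le> \<phi> \<le> \<theta>}\<close>. The area of its intersection with
  the region is computed in polar coordinates with Fubini's theorem. To stay within Borel sets, the
  shifted region is replaced by its interior: the frontier of a convex set is negligible, so again by
  Fubini almost every ray from the origin meets it in a null set, and hence the integral of \<open>\<rho>\<close> along
  such a ray is \<open>(min r (\<beta> \<phi>))\<^sup>2 / 2\<close>. For large \<open>r\<close> this also shows that \<open>\<beta>\<close> agrees almost everywhere
  with a Borel function, so that the two integrands of the claim are integrable separately.\<close>

section \<open>Lebesgue measure on the plane as a product, and the polar coordinate map\<close>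

lemma vector_2_eq_axis: "(vector [a, b] :: real^2) = a *\<^sub>R axis 1 1 + b *\<^sub>R axis 2 1"
  by (simp add: vec_eq_iff forall_2 axis_def)

text \<open>Lebesgue measure is determined by its values on boxes, and these agree. The change of
  variables theorem is about \<open>real^2\<close> while Fubini's theorem is about pairs; this
  identity links the two.\<close>

lemma lborel_real2_eq_distr:
  "(lborel :: (real^2) measure) = distr (lborel :: (real \<times> real) measure) borel (\<lambda>p. vector [fst p, snd p])"
proof (rule lborel_eqI)
  have meas: "(\<lambda>p. vector [fst p, snd p] :: real^2) \<in> borel_measurable borel"
    unfolding vector_2_eq_axis by (intro borel_measurable_continuous_onI continuous_intros)
  fix l u :: "real^2"
  assume le: "\<And>b. b \<in> Basis \<Longrightarrow> l \<bullet> b \<le> u \<bullet> b"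
  have le2: "l $ 1 \<le> u $ 1" "l $ 2 \<le> u $ 2"
    using le[of "axis 1 1"] le[of "axis 2 1"] by (auto simp: inner_axis)
  have "(\<lambda>p. vector [fst p, snd p] :: real^2) -` box l u = box (l $ 1, l $ 2) (u $ 1, u $ 2)"
    by (auto simp: mem_box_cart forall_2 mem_box(1) Basis_prod_def)
  then have "emeasure (distr lborel borel (\<lambda>p. vector [fst p, snd p] :: real^2)) (box l u)
    = emeasure lborel (box (l $ 1, l $ 2) (u $ 1, u $ 2))"
    using meas by (simp add: emeasure_distr)
  also have "\<dots> = ennreal ((u $ 1 - l $ 1) * (u $ 2 - l $ 2))"
    using le2 by (subst emeasure_lborel_box) (auto simp: Basis_prod_def prod.union_disjoint)
  also have "(u $ 1 - l $ 1) * (u $ 2 - l $ 2) = (\<Prod>b\<in>Basis. (u - l) \<bullet> b)"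
    by (simp add: Basis_vec_def UNIV_2 inner_axis axis_eq_axis)
  finally show "emeasure (distr lborel borel (\<lambda>p. vector [fst p, snd p] :: real^2)) (box l u)
    = ennreal (\<Prod>b\<in>Basis. (u - l) \<bullet> b)" .
qed simp

lemma polar_point_eq_axis:
  "polar_point \<rho> \<phi> = (\<rho> * cos \<phi>) *\<^sub>R axis 1 1 + (\<rho> * sin \<phi>) *\<^sub>R axis 2 1"
  by (simp add: polar_point_def vector_2_eq_axis)

lemma norm_polar_point: "norm (polar_point \<rho> \<phi>) = \<bar>\<rho>\<bar>"
proof -
  have "(\<rho> * cos \<phi>)\<^sup>2 + (\<rho> * sin \<phi>)\<^sup>2 = \<rho>\<^sup>2 * ((cos \<phi>)\<^sup>2 + (sin \<phi>)\<^sup>2)"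
    by (simp only: power_mult_distrib distrib_left)
  then show ?thesis
    by (simp add: polar_point_def norm_vec_def L2_set_def UNIV_2)
qed

lemma measurable_polar_point [measurable (raw)]:
  assumes [measurable]: "f \<in> borel_measurable M" "g \<in> borel_measurable M"
  shows "(\<lambda>x. polar_point (f x) (g x)) \<in> borel_measurable M"
  unfolding polar_point_eq_axis by measurable

text \<open>Radius and angle are packed into one vector because the change of variables theorem
  expects a map from \<open>real^2\<close> to itself.\<close>

definition polar_map :: "real^2 \<Rightarrow> real^2" where
  "polar_map x = polar_point (x $ 1) (x $ 2)"

lemma has_derivative_polar_map:
  fixes x :: "real^2"
  shows "(polar_map has_derivative
    (\<lambda>h. vector [h $ 1 * cos (x $ 2) - x $ 1 * sin (x $ 2) * h $ 2,
                 h $ 1 * sin (x $ 2) + x $ 1 * cos (x $ 2) * h $ 2])) (at x within S)"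
  unfolding polar_map_def [abs_def] polar_point_eq_axis vector_2_eq_axis
  by (auto intro!: derivative_eq_intros bounded_linear_imp_has_derivative bounded_linear_vec_nth
      simp: algebra_simps)

text \<open>The Jacobian determinant of polar coordinates is the radius, by \<open>cos\<close>
  squared plus \<open>sin\<close> squared equal to 1.\<close>

lemma det_polar_map:
  fixes x :: "real^2"
  shows "det (matrix (\<lambda>h::real^2. vector [h $ 1 * cos (x $ 2) - x $ 1 * sin (x $ 2) * h $ 2,
                 h $ 1 * sin (x $ 2) + x $ 1 * cos (x $ 2) * h $ 2] :: real^2)) = x $ 1"
proof -
  have "x $ 1 * (cos (x $ 2))\<^sup>2 + x $ 1 * (sin (x $ 2))\<^sup>2 = x $ 1 * ((cos (x $ 2))\<^sup>2 + (sin (x $ 2))\<^sup>2)"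
    by (simp only: distrib_left)
  then show ?thesis
    by (simp add: det_2 matrix_def axis_def power2_eq_square algebra_simps)
qed

text \<open>Taking norms gives equal radii. A positive radius can be cancelled, so the angles have
  the same sine and cosine and differ by a multiple of \<open>2 * pi\<close>; in a half-open
  interval of that length this multiple is zero.\<close>

lemma polar_point_inject:
  assumes "polar_point \<rho> \<phi> = polar_point \<rho>' \<phi>'" "\<rho> > 0" "\<rho>' \<ge> 0"
    "\<phi> \<in> {0..<2 * pi}" "\<phi>' \<in> {0..<2 * pi}"
  shows "\<rho> = \<rho>' \<and> \<phi> = \<phi>'"
proof -
  have "\<rho> = \<rho>'"
    using assms norm_polar_point[of \<rho> \<phi>] norm_polar_point[of \<rho>' \<phi>'] by simp
  with assms have "cos \<phi> = cos \<phi>' \<and> sin \<phi> = sin \<phi>'"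
    by (simp add: polar_point_def vec_eq_iff forall_2)
  then obtain n :: int where n: "\<phi> = \<phi>' + 2 * pi * n"
    using sin_cos_eq_iff[of \<phi> \<phi>'] by auto
  have "n = 0"
  proof (rule ccontr)
    assume "n \<noteq> 0"
    then have "\<bar>real_of_int n\<bar> \<ge> 1"
      by linarith
    then have "2 * pi * \<bar>real_of_int n\<bar> \<ge> 2 * pi"
      by simp
    moreover have "2 * pi * \<bar>real_of_int n\<bar> = \<bar>\<phi> - \<phi>'\<bar>"
      using n by (simp add: abs_mult)
    ultimately show False
      using assms by auto
  qed
  with n \<open>\<rho> = \<rho>'\<close> show ?thesis
    by simp
qed


section \<open>Areas in polar coordinates, by change of variables and Fubini's theorem\<close>

definition radial_integral :: "(real^2) set \<Rightarrow> real \<Rightarrow> real \<Rightarrow> real" where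
  "radial_integral S r \<phi> = (LINT \<rho>|lborel. indicator {0<..<r} \<rho> * \<rho> * indicator S (polar_point \<rho> \<phi>))"

lemma mem_polar_box: "x \<in> box 0 (vector [r, \<theta>] :: real^2) \<longleftrightarrow> 0 < x $ 1 \<and> x $ 1 < r \<and> 0 < x $ 2 \<and> x $ 2 < \<theta>"
  by (auto simp: mem_box_cart forall_2)

text \<open>The integrand is Borel, bounded by \<open>r\<close>, and vanishes outside a rectangle of
  finite area.\<close>

lemma integrable_polar_integrand:
  assumes S [measurable]: "S \<in> sets borel" and "r \<ge> 0" "\<theta> \<ge> 0"
  shows "integrable (lborel \<Otimes>\<^sub>M lborel) (\<lambda>(\<rho>, \<phi>). indicator {0<..<\<theta>} \<phi> *
           (indicator {0<..<r} \<rho> * \<rho> * indicator S (polar_point \<rho> \<phi>)) :: real)"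
proof (rule Bochner_Integration.integrable_bound)
  show "integrable (lborel \<Otimes>\<^sub>M lborel) (\<lambda>p. r * indicator ({0<..<r} \<times> {0<..<\<theta>}) p)"
    using assms by (auto simp: lborel.emeasure_pair_measure_Times ennreal_mult_less_top)
qed (auto intro!: AE_I2 simp: indicator_def)

lemma integrable_radial_integral:
  assumes "S \<in> sets borel" "r \<ge> 0" "\<theta> \<ge> 0"
  shows "integrable lborel (\<lambda>\<phi>. indicator {0<..<\<theta>} \<phi> * radial_integral S r \<phi>)"
  using lborel_pair.integrable_snd[OF integrable_polar_integrand[OF assms]]
  by (simp add: radial_integral_def)

text \<open>Change of variables on the part \<open>T\<close> of the parameter box that is mapped
  into \<open>S\<close>, followed by Fubini with the radius as inner variable. The box is open so
  that radii are positive and angles stay strictly below \<open>2 * pi\<close>, which makes the map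
  injective.\<close>

lemma measure_polar_image:
  assumes S [measurable]: "S \<in> sets borel" and "r \<ge> 0" "\<theta> \<in> {0..2 * pi}"
  shows "measure lebesgue (polar_map ` box 0 (vector [r, \<theta>]) \<inter> S) =
    (LINT \<phi>|lborel. indicator {0<..<\<theta>} \<phi> * radial_integral S r \<phi>)"
proof -
  let ?D = "\<lambda>(x::real^2) (h::real^2). vector [h $ 1 * cos (x $ 2) - x $ 1 * sin (x $ 2) * h $ 2,
                 h $ 1 * sin (x $ 2) + x $ 1 * cos (x $ 2) * h $ 2] :: real^2"
  let ?f = "\<lambda>(\<rho>, \<phi>). indicator {0<..<\<theta>} \<phi> *
           (indicator {0<..<r} \<rho> * \<rho> * indicator S (polar_point \<rho> \<phi>)) :: real"
  define T where "T = box 0 (vector [r, \<theta>]) \<inter> polar_map -` S"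
  have img: "polar_map ` box 0 (vector [r, \<theta>]) \<inter> S = polar_map ` T"
    by (auto simp: T_def)
  have pm [measurable]: "polar_map \<in> borel_measurable borel"
    unfolding polar_map_def by measurable
  have T [measurable]: "T \<in> sets borel"
    using measurable_sets[OF pm S] by (auto simp: T_def)
  have vm [measurable]: "(\<lambda>p. vector [fst p, snd p] :: real^2) \<in> borel_measurable borel"
    unfolding vector_2_eq_axis by (intro borel_measurable_continuous_onI continuous_intros)
  \<comment> \<open>Radii are positive on \<open>T\<close>, so the absolute value of the Jacobian is
    the radius itself.\<close>
  have f_eq: "(\<lambda>p. indicator T (vector [fst p, snd p] :: real^2) * \<bar>fst p\<bar>) = ?f"
    by (auto simp: fun_eq_iff T_def mem_polar_box polar_map_def split: split_indicator)
  have int_f: "integrable (lborel \<Otimes>\<^sub>M lborel) ?f"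
    using assms by (intro integrable_polar_integrand) auto
  have intT: "integrable lborel (\<lambda>x::real^2. indicator T x * \<bar>x $ 1\<bar>)"
    unfolding lborel_real2_eq_distr using int_f
    by (subst integrable_distr_eq) (auto simp: f_eq lborel_prod)
  have "((\<lambda>x. \<bar>det (matrix (?D x))\<bar>) has_integral (LINT x|lborel. indicator T x * \<bar>x $ 1\<bar>)) T"
  proof -
    have "(\<lambda>x::real^2. indicator T x * \<bar>x $ 1\<bar>) = (\<lambda>x. if x \<in> T then \<bar>x $ 1\<bar> else 0)"
      by auto
    then show ?thesis
      using has_integral_integral_lborel[OF intT]
      unfolding det_polar_map by (simp only: has_integral_restrict_UNIV)
  qed
  then have "measure lebesgue (polar_map ` T) = (LINT x|lborel. indicator T x * \<bar>x $ 1\<bar>)"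
  proof (subst (asm) has_measure_differentiable_image[symmetric, where f = polar_map])
    show "inj_on polar_map T"
    proof (rule inj_onI)
      fix x y assume "x \<in> T" "y \<in> T" "polar_map x = polar_map y"
      then show "x = y"
        using polar_point_inject[of "x $ 1" "x $ 2" "y $ 1" "y $ 2"] assms
        by (auto simp: T_def mem_polar_box polar_map_def vec_eq_iff forall_2)
    qed
  qed (auto intro!: has_derivative_polar_map)
  also have "\<dots> = (LINT p|(lborel \<Otimes>\<^sub>M lborel). ?f p)"
    by (subst lborel_real2_eq_distr, subst integral_distr) (auto simp: f_eq lborel_prod)
  also have "\<dots> = (LINT \<phi>|lborel. indicator {0<..<\<theta>} \<phi> * radial_integral S r \<phi>)"
    using lborel_pair.integral_snd[OF int_f] by (simp add: radial_integral_def)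
  finally show ?thesis
    using img by simp
qed

text \<open>The polar area formula read backwards: area zero makes the integral of the nonnegative
  radial integrals vanish, so almost all of them are zero. As the weight \<rho> is positive on the
  open interval, such a ray meets \<open>S\<close> in a null set of radii.\<close>

lemma AE_radial_null:
  assumes S [measurable]: "S \<in> sets borel" and "negligible S" and "r \<ge> 0"
  shows "AE \<phi> in lborel. \<phi> \<in> {0<..<2 * pi} \<longrightarrow> (AE \<rho> in lborel. \<rho> \<in> {0<..<r} \<longrightarrow> polar_point \<rho> \<phi> \<notin> S)"
proof -
  have "measure lebesgue (polar_map ` box 0 (vector [r, 2 * pi]) \<inter> S) = 0"
    by (meson assms(2) inf_le2 negligible_imp_measure0 negligible_subset)
  then have "(LINT \<phi>|lborel. indicator {0<..<2 * pi} \<phi> * radial_integral S r \<phi>) = 0"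
    using measure_polar_image[OF S \<open>r \<ge> 0\<close>, of "2 * pi"] by simp
  moreover have "radial_integral S r \<phi> \<ge> 0" for \<phi>
    unfolding radial_integral_def by (intro integral_nonneg_AE) (auto split: split_indicator)
  ultimately have "AE \<phi> in lborel. indicator {0<..<2 * pi} \<phi> * radial_integral S r \<phi> = 0"
    using integral_nonneg_eq_0_iff_AE[OF integrable_radial_integral[OF S \<open>r \<ge> 0\<close>, of "2 * pi"]] by simp
  then show ?thesis
  proof (rule eventually_mono, intro impI)
    fix \<phi> :: real
    assume "indicator {0<..<2 * pi} \<phi> * radial_integral S r \<phi> = 0" "\<phi> \<in> {0<..<2 * pi}"
    then have 0: "radial_integral S r \<phi> = 0"
      by simp
    \<comment> \<open>The Bochner integral of a non-integrable function is 0 by default, so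
      integrability has to be secured before a zero integral yields vanishing almost
      everywhere.\<close>
    have "integrable lborel (\<lambda>\<rho>. indicator {0<..<r} \<rho> * \<rho> * indicator S (polar_point \<rho> \<phi>))"
    proof (rule Bochner_Integration.integrable_bound)
      show "integrable lborel (\<lambda>\<rho>. r * indicator {0<..<r} \<rho>)"
        using \<open>r \<ge> 0\<close> by simp
    qed (auto split: split_indicator)
    then have "AE \<rho> in lborel. indicator {0<..<r} \<rho> * \<rho> * indicator S (polar_point \<rho> \<phi>) = 0"
      using 0 unfolding radial_integral_def
      by (subst (asm) integral_nonneg_eq_0_iff_AE) (auto split: split_indicator)
    then show "AE \<rho> in lborel. \<rho> \<in> {0<..<r} \<longrightarrow> polar_point \<rho> \<phi> \<notin> S"
      by (rule AE_mp) (auto split: split_indicator)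
  qed
qed


section \<open>Rays in the shifted region and their radial extent\<close>

lemma
  assumes bdd: "bounded K" and conv: "convex K" and "u \<in> K"
  shows bounded_shifted_region: "bounded (shifted_region K u)"
    and convex_shifted_region: "convex (shifted_region K u)"
    and zero_in_shifted_region: "0 \<in> shifted_region K u"
proof -
  have eq: "shifted_region K u = (\<lambda>v. v - u) ` K"
    by (auto simp: shifted_region_def)
  show "bounded (shifted_region K u)"
    unfolding eq using bdd by (rule bounded_translation_minus)
  show "convex (shifted_region K u)"
    unfolding eq using conv by (rule convex_translation_subtract)
  show "0 \<in> shifted_region K u"
    unfolding eq using \<open>u \<in> K\<close> by force
qed

text \<open>The admissible radii in a direction are bounded and include 0, so their supremum is a
  genuine one. By convexity they form an interval starting at 0; whether it contains its right
  endpoint is left open.\<close>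

lemma
  fixes K :: "(real^2) set"
  assumes "bounded K" "convex K" "u \<in> K"
  shows radial_extent_bounds: "\<exists>B\<ge>0. \<forall>\<phi>. 0 \<le> radial_extent K u \<phi> \<and> radial_extent K u \<phi> \<le> B"
    and polar_point_in_shifted_region:
      "0 \<le> \<rho> \<Longrightarrow> \<rho> < radial_extent K u \<phi> \<Longrightarrow> polar_point \<rho> \<phi> \<in> shifted_region K u"
    and polar_point_notin_shifted_region:
      "0 \<le> \<rho> \<Longrightarrow> radial_extent K u \<phi> < \<rho> \<Longrightarrow> polar_point \<rho> \<phi> \<notin> shifted_region K u"
proof -
  let ?C = "shifted_region K u"
  let ?X = "\<lambda>\<phi>. {\<rho>. \<rho> \<ge> 0 \<and> polar_point \<rho> \<phi> \<in> ?C}"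
  obtain B where B: "\<And>x. x \<in> ?C \<Longrightarrow> norm x \<le> B"
    using bounded_shifted_region[OF assms] by (auto simp: bounded_iff)
  have X: "?X \<phi> \<subseteq> {0..B}" for \<phi>
    using B by (fastforce simp: norm_polar_point)
  have X0: "0 \<in> ?X \<phi>" for \<phi>
    using zero_in_shifted_region[OF assms] by (simp add: polar_point_eq_axis)
  have bdd: "bdd_above (?X \<phi>)" for \<phi>
    using X by (rule bdd_above_mono[OF bdd_above_Icc])
  have "0 \<le> radial_extent K u \<phi> \<and> radial_extent K u \<phi> \<le> B" for \<phi>
    unfolding radial_extent_def
  proof
    show "0 \<le> Sup (?X \<phi>)"
      by (rule cSup_upper[OF X0 bdd])
    show "Sup (?X \<phi>) \<le> B"
      using X[of \<phi>] X0[of \<phi>] by (intro cSup_least) auto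
  qed
  then show "\<exists>B\<ge>0. \<forall>\<phi>. 0 \<le> radial_extent K u \<phi> \<and> radial_extent K u \<phi> \<le> B"
    by (meson order_trans)
  show "polar_point \<rho> \<phi> \<notin> ?C" if "0 \<le> \<rho>" "radial_extent K u \<phi> < \<rho>"
    using that cSup_upper[OF _ bdd[of \<phi>], of \<rho>] unfolding radial_extent_def by auto
  show "polar_point \<rho> \<phi> \<in> ?C" if \<rho>: "0 \<le> \<rho>" "\<rho> < radial_extent K u \<phi>"
  proof -
    obtain s where s: "s \<in> ?X \<phi>" "\<rho> < s"
    proof (rule less_cSupE)
      show "\<rho> < Sup (?X \<phi>)"
        using \<rho> by (simp only: radial_extent_def)
      show "?X \<phi> \<noteq> {}"
        using X0[of \<phi>] by (metis empty_iff)
    qed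
    \<comment> \<open>The point at radius \<rho> is a convex combination of the origin and a point
      of the region farther out on the same ray.\<close>
    have "(\<rho> / s) *\<^sub>R polar_point s \<phi> + (1 - \<rho> / s) *\<^sub>R 0 \<in> ?C"
      using s \<rho> zero_in_shifted_region[OF assms]
      by (intro convexD[OF convex_shifted_region[OF assms]]) auto
    also have "(\<rho> / s) *\<^sub>R polar_point s \<phi> + (1 - \<rho> / s) *\<^sub>R 0 = polar_point \<rho> \<phi>"
      using s \<rho> by (simp add: polar_point_eq_axis scaleR_add_right)
    finally show ?thesis .
  qed
qed

text \<open>On almost every ray the frontier is met in a null set of radii. There the interior and
  the region agree up to a null set, and what remains is the integral of \<rho> from 0 to the
  smaller of \<open>r\<close> and the radial extent.\<close>

lemma AE_radial_integral_interior:
  fixes K :: "(real^2) set"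
  assumes K: "bounded K" "convex K" "u \<in> K" and "r \<ge> 0"
  shows "AE \<phi> in lborel. \<phi> \<in> {0<..<2 * pi} \<longrightarrow>
    radial_integral (interior (shifted_region K u)) r \<phi> = (min r (radial_extent K u \<phi>))\<^sup>2 / 2"
proof -
  let ?C = "shifted_region K u"
  have "negligible (frontier ?C)"
    by (rule negligible_convex_frontier[OF convex_shifted_region[OF K]])
  then have "AE \<phi> in lborel. \<phi> \<in> {0<..<2 * pi} \<longrightarrow>
      (AE \<rho> in lborel. \<rho> \<in> {0<..<r} \<longrightarrow> polar_point \<rho> \<phi> \<notin> frontier ?C)"
    using \<open>r \<ge> 0\<close> by (intro AE_radial_null) auto
  then show ?thesis
  proof (rule eventually_mono, intro impI)
    fix \<phi> :: real
    let ?m = "min r (radial_extent K u \<phi>)"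
    assume "\<phi> \<in> {0<..<2 * pi} \<longrightarrow>
      (AE \<rho> in lborel. \<rho> \<in> {0<..<r} \<longrightarrow> polar_point \<rho> \<phi> \<notin> frontier ?C)" "\<phi> \<in> {0<..<2 * pi}"
    then have "AE \<rho> in lborel. \<rho> \<in> {0<..<r} \<longrightarrow> polar_point \<rho> \<phi> \<notin> frontier ?C"
      by simp
    \<comment> \<open>At the endpoint \<open>?m\<close> the two sides may differ: the open interval
      omits \<open>r\<close>, and the boundary point of the region need not belong to its interior.
      The exponent 1 fits the shape of \<open>integral_power\<close>.\<close>
    then have AE: "AE \<rho> in lborel. indicator {0<..<r} \<rho> * \<rho> * indicator (interior ?C) (polar_point \<rho> \<phi>)
        = \<rho> ^ 1 * indicator {0..?m} \<rho>"
      using AE_lborel_singleton[of 0] AE_lborel_singleton[of ?m]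
    proof eventually_elim
      case (elim \<rho>)
      then have "polar_point \<rho> \<phi> \<in> interior ?C \<longleftrightarrow> polar_point \<rho> \<phi> \<in> ?C" if "\<rho> \<in> {0<..<r}"
        using that interior_subset[of ?C] closure_subset[of ?C] by (auto simp: frontier_def)
      then show ?case
        using elim polar_point_in_shifted_region[OF K, of \<rho> \<phi>]
          polar_point_notin_shifted_region[OF K, of \<rho> \<phi>]
        by (auto simp: indicator_def min_def split: if_splits)
    qed
    have [measurable]: "interior ?C \<in> sets borel"
      by simp
    have "(\<lambda>\<rho>. indicator {0<..<r} \<rho> * \<rho> * indicator (interior ?C) (polar_point \<rho> \<phi>) :: real)
        \<in> borel_measurable lborel"
      by measurable
    then have "radial_integral (interior ?C) r \<phi> = (LINT \<rho>|lborel. \<rho> ^ 1 * indicator {0..?m} \<rho>)"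
      unfolding radial_integral_def using AE by (intro integral_cong_AE) measurable
    also have "\<dots> = ?m\<^sup>2 / 2"
      using radial_extent_bounds[OF K] \<open>r \<ge> 0\<close> by (subst integral_power) (auto simp: power2_eq_square)
    finally show "radial_integral (interior ?C) r \<phi> = ?m\<^sup>2 / 2" .
  qed
qed

section \<open>Integrating over the angle\<close>

text \<open>Passes from the Lebesgue integral to the gauge integral of the claim. The latter ignores
  null sets and endpoints, so \<open>f\<close> itself need not be shown Borel.\<close>

lemma has_integral_Icc_if_AE_eq:
  fixes f h :: "real \<Rightarrow> real"
  assumes int: "integrable lborel (\<lambda>\<phi>. indicator {0<..<\<theta>} \<phi> * h \<phi>)"
    and AE: "AE \<phi> in lborel. \<phi> \<in> {0<..<\<theta>} \<longrightarrow> f \<phi> = h \<phi>"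
  shows "(f has_integral (LINT \<phi>|lborel. indicator {0<..<\<theta>} \<phi> * h \<phi>)) {0..\<theta>}"
proof -
  have "(\<lambda>\<phi>. indicator {0<..<\<theta>} \<phi> * h \<phi>) = (\<lambda>\<phi>. if \<phi> \<in> {0<..<\<theta>} then h \<phi> else 0)"
    by auto
  then have "(h has_integral (LINT \<phi>|lborel. indicator {0<..<\<theta>} \<phi> * h \<phi>)) {0<..<\<theta>}"
    using has_integral_integral_lborel[OF int] by (simp only: has_integral_restrict_UNIV)
  then have "(f has_integral (LINT \<phi>|lborel. indicator {0<..<\<theta>} \<phi> * h \<phi>)) {0<..<\<theta>}"
    using has_integral_AE[OF AE] by blast
  then show ?thesis
    using has_integral_Icc_iff_Ioo by blast
qed


text \<open>A supremum over uncountably many radii is not evidently Borel in the angle. For a radius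
  \<open>B\<close> that bounds the radial extent, however, the radial integral is half its square,
  and Fubini's theorem makes that integral Borel in the angle.\<close>

lemma radial_extent_AE_borel:
  fixes K :: "(real^2) set"
  assumes K: "bounded K" "convex K" "u \<in> K"
  obtains g where "g \<in> borel_measurable borel" "\<And>\<phi>. g \<phi> \<ge> 0"
    "AE \<phi> in lborel. \<phi> \<in> {0<..<2 * pi} \<longrightarrow> radial_extent K u \<phi> = g \<phi>"
proof -
  obtain B where B: "B \<ge> 0" "\<And>\<phi>. 0 \<le> radial_extent K u \<phi>" "\<And>\<phi>. radial_extent K u \<phi> \<le> B"
    using radial_extent_bounds[OF K] by blast
  define F where "F \<phi> = indicator {0<..<2 * pi} \<phi> * radial_integral (interior (shifted_region K u)) B \<phi>" for \<phi>
  have [measurable]: "F \<in> borel_measurable borel"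
    using integrable_radial_integral[of "interior (shifted_region K u)" B "2 * pi"] B(1)
    unfolding F_def by auto
  show ?thesis
  proof
    \<comment> \<open>The witness solves
      \<open>F \<phi> = (radial_extent K u \<phi>)\<^sup>2 / 2\<close> for the radial extent; the
      absolute value makes it nonnegative at every angle.\<close>
    show "(\<lambda>\<phi>. sqrt (2 * \<bar>F \<phi>\<bar>)) \<in> borel_measurable borel"
      by measurable
    show "AE \<phi> in lborel. \<phi> \<in> {0<..<2 * pi} \<longrightarrow> radial_extent K u \<phi> = sqrt (2 * \<bar>F \<phi>\<bar>)"
      using AE_radial_integral_interior[OF K B(1)]
    proof eventually_elim
      case (elim \<phi>)
      have "sqrt (2 * \<bar>F \<phi>\<bar>) = radial_extent K u \<phi>" if "\<phi> \<in> {0<..<2 * pi}"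
      proof -
        have F: "F \<phi> = (radial_extent K u \<phi>)\<^sup>2 / 2"
          using elim that B(3)[of \<phi>] by (simp add: F_def min_absorb2)
        show ?thesis
          unfolding F using B(2)[of \<phi>] by simp
      qed
      then show ?case
        by simp
    qed
  qed simp
qed

text \<open>The square of the minimum of \<open>r\<close> and the radial extent splits according to
  which of the two is smaller. Splitting its integral requires both pieces to be integrable, which
  comes from the Borel version \<open>g\<close> of the radial extent.\<close>

lemma measure_polar_box_interior:
  fixes K :: "(real^2) set"
  assumes K: "bounded K" "convex K" "u \<in> K" and r: "r \<ge> 0" and \<theta>: "\<theta> \<in> {0..2 * pi}"
  shows "measure lebesgue (polar_map ` box 0 (vector [r, \<theta>]) \<inter> interior (shifted_region K u)) =
      1 / 2 * integral {0..\<theta>} (\<lambda>\<phi>. r\<^sup>2 * of_bool (r \<le> radial_extent K u \<phi>)) +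
      1 / 2 * integral {0..\<theta>} (\<lambda>\<phi>. (radial_extent K u \<phi>)\<^sup>2 * of_bool (r > radial_extent K u \<phi>))"
proof -
  let ?f1 = "\<lambda>\<phi>. r\<^sup>2 * of_bool (r \<le> radial_extent K u \<phi>)"
  let ?f2 = "\<lambda>\<phi>. (radial_extent K u \<phi>)\<^sup>2 * of_bool (r > radial_extent K u \<phi>)"
  let ?D = "interior (shifted_region K u)"
  obtain g where g [measurable]: "g \<in> borel_measurable borel" and g0: "\<And>\<phi>. g \<phi> \<ge> 0"
    and AE_g: "AE \<phi> in lborel. \<phi> \<in> {0<..<2 * pi} \<longrightarrow> radial_extent K u \<phi> = g \<phi>"
    using radial_extent_AE_borel[OF K] by blast
  have bound: "integrable lborel (\<lambda>\<phi>. indicator {0<..<\<theta>} \<phi> * h \<phi>)"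
    if [measurable]: "h \<in> borel_measurable borel" and h: "\<And>\<phi>. \<bar>h \<phi>\<bar> \<le> r\<^sup>2" for h :: "real \<Rightarrow> real"
  proof (rule Bochner_Integration.integrable_bound)
    show "integrable lborel (\<lambda>\<phi>. r\<^sup>2 * indicator {0<..<\<theta>} \<phi>)"
      using \<theta> by simp
  qed (use h in \<open>auto intro!: AE_I2 simp: indicator_def\<close>)
  have "integrable lborel (\<lambda>\<phi>. indicator {0<..<\<theta>} \<phi> * (r\<^sup>2 * of_bool (r \<le> g \<phi>)))"
    by (intro bound) auto
  then have 1: "?f1 integrable_on {0..\<theta>}"
    by (rule has_integral_integrable[OF has_integral_Icc_if_AE_eq]) (use AE_g \<theta> in \<open>eventually_elim, auto\<close>)
  \<comment> \<open>Where \<open>g \<phi> < r\<close>, nonnegativity of \<open>g\<close> keeps its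
    square below that of \<open>r\<close>.\<close>
  have "integrable lborel (\<lambda>\<phi>. indicator {0<..<\<theta>} \<phi> * ((g \<phi>)\<^sup>2 * of_bool (r > g \<phi>)))"
    using g0 by (intro bound) (auto intro!: power_mono)
  then have 2: "?f2 integrable_on {0..\<theta>}"
    by (rule has_integral_integrable[OF has_integral_Icc_if_AE_eq]) (use AE_g \<theta> in \<open>eventually_elim, auto\<close>)
  have "integrable lborel (\<lambda>\<phi>. indicator {0<..<\<theta>} \<phi> * (2 * radial_integral ?D r \<phi>))"
    using integrable_mult_right[OF integrable_radial_integral[of ?D r \<theta>], of 2] r \<theta>
    by (simp add: mult.left_commute)
  moreover have "AE \<phi> in lborel. \<phi> \<in> {0<..<\<theta>} \<longrightarrow> ?f1 \<phi> + ?f2 \<phi> = 2 * radial_integral ?D r \<phi>"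
    using AE_radial_integral_interior[OF K r] by eventually_elim (use \<theta> in \<open>auto simp: min_def\<close>)
  ultimately have "((\<lambda>\<phi>. ?f1 \<phi> + ?f2 \<phi>) has_integral
      (LINT \<phi>|lborel. indicator {0<..<\<theta>} \<phi> * (2 * radial_integral ?D r \<phi>))) {0..\<theta>}"
    by (rule has_integral_Icc_if_AE_eq)
  then have "integral {0..\<theta>} ?f1 + integral {0..\<theta>} ?f2 =
      (LINT \<phi>|lborel. indicator {0<..<\<theta>} \<phi> * (2 * radial_integral ?D r \<phi>))"
    using integral_add[OF 1 2] by (simp only: integral_unique)
  also have "\<dots> = 2 * (LINT \<phi>|lborel. indicator {0<..<\<theta>} \<phi> * radial_integral ?D r \<phi>)"
    by (simp add: mult.left_commute)
  also have "\<dots> = 2 * measure lebesgue (polar_map ` box 0 (vector [r, \<theta>]) \<inter> ?D)"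
    using r \<theta> by (subst measure_polar_image) auto
  finally show ?thesis
    by simp
qed

section \<open>From the open sector in the interior to the probability of the event\<close>

text \<open>The closed sector is compact, hence a Borel event for \<open>V\<close>, while the open
  box suits the change of variables. After translation by \<open>u\<close> the two sets differ only
  within the image of the boundary of the box and the frontier of the region; both are negligible,
  since differentiable maps preserve null sets.\<close>

lemma measure_polar_cbox:
  fixes K :: "(real^2) set"
  assumes K: "bounded K" "convex K" "u \<in> K"
  shows "measure lebesgue ((+) u ` polar_map ` cbox 0 (vector [r, \<theta>]) \<inter> K) =
    measure lebesgue (polar_map ` box 0 (vector [r, \<theta>]) \<inter> interior (shifted_region K u))"
proof -
  let ?C = "shifted_region K u" and ?c = "cbox 0 (vector [r, \<theta>]) :: (real^2) set"
    and ?b = "box 0 (vector [r, \<theta>]) :: (real^2) set"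
  have "(+) u ` polar_map ` ?c \<inter> K = (+) u ` (polar_map ` ?c \<inter> ?C)"
    by (force simp: shifted_region_def)
  then have "measure lebesgue ((+) u ` polar_map ` ?c \<inter> K) = measure lebesgue (polar_map ` ?c \<inter> ?C)"
    by (simp add: measure_translation)
  also have "\<dots> = measure lebesgue (polar_map ` ?b \<inter> interior ?C)"
  proof (rule measure_negligible_symdiff[symmetric])
    have diff: "polar_map differentiable_on A" for A
      using has_derivative_polar_map unfolding differentiable_on_def differentiable_def by blast
    have "compact (polar_map ` ?c)"
      using diff by (intro compact_continuous_image differentiable_imp_continuous_on) auto
    then show "polar_map ` ?c \<inter> ?C \<in> lmeasurable"
      by (intro fmeasurable.Int[OF lmeasurable_compact]
          measurable_convex[OF convex_shifted_region[OF K] bounded_shifted_region[OF K]])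
    have "negligible (polar_map ` (?c - ?b))"
      by (rule negligible_differentiable_image_negligible[OF _ negligible_frontier_interval diff]) simp
    moreover have "negligible (frontier ?C)"
      by (rule negligible_convex_frontier[OF convex_shifted_region[OF K]])
    ultimately have "negligible (polar_map ` (?c - ?b) \<union> frontier ?C)"
      by simp
    then show "negligible (polar_map ` ?c \<inter> ?C - polar_map ` ?b \<inter> interior ?C \<union>
        (polar_map ` ?b \<inter> interior ?C - polar_map ` ?c \<inter> ?C))"
    proof (rule negligible_subset)
      show "polar_map ` ?c \<inter> ?C - polar_map ` ?b \<inter> interior ?C \<union>
        (polar_map ` ?b \<inter> interior ?C - polar_map ` ?c \<inter> ?C) \<subseteq> polar_map ` (?c - ?b) \<union> frontier ?C"
        using interior_subset[of ?C] closure_subset[of ?C] box_subset_cbox[of 0 "vector [r, \<theta>] :: real^2"]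
        by (fastforce simp: frontier_def)
    qed
  qed
  finally show ?thesis .
qed

theorem mainTheorem6:
  fixes K :: "(real^2) set" and u :: "real^2"
    and M :: "'w measure" and V :: "'w \<Rightarrow> real^2" and R \<Theta> :: "'w \<Rightarrow> real"
    and r \<theta> :: real
  assumes "bounded K" and "convex K" and "measure lebesgue K > 0"
    and "center_of_mass K = 0"
    and "u \<in> K"
    and "prob_space M"
    and "uniformly_distributed_in M V K"
    and "R \<in> borel_measurable M" and "\<Theta> \<in> borel_measurable M"
    and "\<And>\<omega>. \<omega> \<in> space M \<Longrightarrow>
           R \<omega> \<ge> 0 \<and> \<Theta> \<omega> \<in> {0..<2 * pi} \<and> V \<omega> - u = polar_point (R \<omega>) (\<Theta> \<omega>)"
    and "r \<ge> 0" and "\<theta> \<in> {0..2 * pi}"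
  shows "measure M {\<omega> \<in> space M. R \<omega> \<le> r \<and> \<Theta> \<omega> \<le> \<theta>} =
    1 / measure lebesgue K *
      (1 / 2 * integral {0..\<theta>} (\<lambda>\<phi>. r\<^sup>2 * of_bool (r \<le> radial_extent K u \<phi>)) +
       1 / 2 * integral {0..\<theta>} (\<lambda>\<phi>. (radial_extent K u \<phi>)\<^sup>2 * of_bool (r > radial_extent K u \<phi>)))"
proof -
  note K = \<open>bounded K\<close> \<open>convex K\<close> \<open>u \<in> K\<close>
  note unif = \<open>uniformly_distributed_in M V K\<close>
  interpret prob_space M by fact
  let ?c = "cbox 0 (vector [r, \<theta>]) :: (real^2) set"
  let ?A = "(+) u ` polar_map ` ?c"
  have V [measurable]: "V \<in> borel_measurable M"
    and prob_V: "\<And>A. A \<in> sets borel \<Longrightarrow>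
      measure M (V -` A \<inter> space M) = measure lebesgue (A \<inter> K) / measure lebesgue K"
    using unif by (auto simp: uniformly_distributed_in_def)
  have RT: "R \<omega> \<ge> 0" "0 \<le> \<Theta> \<omega>" "\<Theta> \<omega> < 2 * pi" "V \<omega> - u = polar_point (R \<omega>) (\<Theta> \<omega>)"
    if "\<omega> \<in> space M" for \<omega>
    using assms(10)[OF that] by auto
  have r: "r \<ge> 0" and \<theta>: "0 \<le> \<theta>" "\<theta> \<le> 2 * pi"
    using assms by auto
  note [measurable] = \<open>R \<in> borel_measurable M\<close> \<open>\<Theta> \<in> borel_measurable M\<close>
  let ?E = "{\<omega> \<in> space M. R \<omega> \<le> r \<and> \<Theta> \<omega> \<le> \<theta>}"
  have mem_A: "v \<in> ?A \<longleftrightarrow> (\<exists>\<rho> \<phi>. 0 \<le> \<rho> \<and> \<rho> \<le> r \<and> 0 \<le> \<phi> \<and> \<phi> \<le> \<theta> \<and> v - u = polar_point \<rho> \<phi>)" for v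
  proof
    assume "v \<in> ?A"
    then show "\<exists>\<rho> \<phi>. 0 \<le> \<rho> \<and> \<rho> \<le> r \<and> 0 \<le> \<phi> \<and> \<phi> \<le> \<theta> \<and> v - u = polar_point \<rho> \<phi>"
      by (fastforce simp: mem_box_cart forall_2 polar_map_def)
  next
    assume "\<exists>\<rho> \<phi>. 0 \<le> \<rho> \<and> \<rho> \<le> r \<and> 0 \<le> \<phi> \<and> \<phi> \<le> \<theta> \<and> v - u = polar_point \<rho> \<phi>"
    then obtain \<rho> \<phi> where *: "0 \<le> \<rho>" "\<rho> \<le> r" "0 \<le> \<phi>" "\<phi> \<le> \<theta>" "v - u = polar_point \<rho> \<phi>"
      by blast
    then have "vector [\<rho>, \<phi>] \<in> ?c" "v = u + polar_map (vector [\<rho>, \<phi>])"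
      by (auto simp: mem_box_cart forall_2 polar_map_def algebra_simps)
    then show "v \<in> ?A"
      by blast
  qed
  \<comment> \<open>The law of \<open>V\<close> is given on Borel sets only; compactness shows that
    the sector is one.\<close>
  have "continuous_on ?c polar_map"
    using has_derivative_polar_map by (rule has_derivative_continuous_on)
  then have "compact ?A"
    by (intro compact_translation compact_continuous_image) auto
  then have A: "?A \<in> sets borel"
    by (intro borel_closed compact_imp_closed)
  \<comment> \<open>The apex \<open>u\<close> lies in the sector through radius 0, so outcomes with
    \<open>V \<omega> = u\<close> are in the preimage whatever their value of \<Theta>. They are the
    only possible excess over the event.\<close>
  have "V -` ?A \<inter> space M = ?E \<union> (V -` {u} \<inter> space M)"
  proof (intro set_eqI iffI)
    fix \<omega> assume \<omega>: "\<omega> \<in> V -` ?A \<inter> space M"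
    show "\<omega> \<in> ?E \<union> (V -` {u} \<inter> space M)"
    proof (cases "V \<omega> = u")
      case False
      obtain \<rho> \<phi> where p: "0 \<le> \<rho>" "\<rho> \<le> r" "0 \<le> \<phi>" "\<phi> \<le> \<theta>" "V \<omega> - u = polar_point \<rho> \<phi>"
        using \<omega> mem_A[of "V \<omega>"] by auto
      have "\<rho> \<noteq> 0"
        using False p by (auto simp: polar_point_eq_axis)
      \<comment> \<open>If \<theta> is \<open>2 * pi\<close>, the closed sector admits the angle
        \<open>2 * pi\<close>, a value \<Theta> never takes; it describes the same ray as the angle
        0.\<close>
      define \<phi>' where "\<phi>' = (if \<phi> = 2 * pi then 0 else \<phi>)"
      have "polar_point \<rho> \<phi>' = polar_point (R \<omega>) (\<Theta> \<omega>)"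
        using p RT[of \<omega>] \<omega> by (auto simp: \<phi>'_def polar_point_def)
      then have "\<rho> = R \<omega> \<and> \<phi>' = \<Theta> \<omega>"
        using p RT[of \<omega>] \<omega> \<open>\<rho> \<noteq> 0\<close> \<theta> by (intro polar_point_inject) (auto simp: \<phi>'_def)
      then show ?thesis
        using p \<omega> \<theta> by (auto simp: \<phi>'_def split: if_splits)
    qed (use \<omega> in auto)
  next
    fix \<omega> assume "\<omega> \<in> ?E \<union> (V -` {u} \<inter> space M)"
    then show "\<omega> \<in> V -` ?A \<inter> space M"
    proof
      assume "\<omega> \<in> ?E"
      then show ?thesis
        using RT[of \<omega>] mem_A[of "V \<omega>"] by auto
    next
      assume "\<omega> \<in> V -` {u} \<inter> space M"
      moreover have "u \<in> ?A"
        unfolding mem_A using r \<theta> by (intro exI[of _ 0]) (auto simp: polar_point_eq_axis)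
      ultimately show ?thesis
        by auto
    qed
  qed
  moreover have "V -` {u} \<inter> space M \<in> null_sets M"
  proof -
    have "negligible ({u} \<inter> K)"
      by (rule negligible_subset[OF negligible_sing]) auto
    then have "measure M (V -` {u} \<inter> space M) = 0"
      using prob_V[of "{u}"] by (simp add: negligible_imp_measure0)
    then show ?thesis
      by (auto simp: null_sets_def emeasure_eq_measure)
  qed
  ultimately have "measure M ?E = measure M (V -` ?A \<inter> space M)"
    by (simp add: measure_Un_null_set)
  also have "\<dots> = measure lebesgue (?A \<inter> K) / measure lebesgue K"
    by (rule prob_V[OF A])
  also have "\<dots> = 1 / measure lebesgue K * measure lebesgue (?A \<inter> K)"
    by simp
  also have "measure lebesgue (?A \<inter> K) =
      1 / 2 * integral {0..\<theta>} (\<lambda>\<phi>. r\<^sup>2 * of_bool (r \<le> radial_extent K u \<phi>)) +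
      1 / 2 * integral {0..\<theta>} (\<lambda>\<phi>. (radial_extent K u \<phi>)\<^sup>2 * of_bool (r > radial_extent K u \<phi>))"
    using r \<theta> by (simp only: measure_polar_cbox[OF K]) (intro measure_polar_box_interior[OF K], auto)
  finally show ?thesis .
qed

end
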